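(* Fix a compatible utility system $\mathbf U$ for the grand preference $\mathcal P$. Let $\mathfrak X'=(\{\mathcal X'_t\},\{\varsigma'_t\},\{\Gamma'_t\})$ be a PA-state system and let $\mathcal V'$ be a PA recursive structure on $\mathfrak X'$. Suppose that $(\mathfrak X',\mathcal V')$ factorizes $\mathbf U$ through summary maps $\boldsymbol\sigma'=\{\sigma'_t\}_{t=0}^{T+1}$. Then there exists a unique memory correspondence $\{\theta_t\}_{t=0}^{T+1}$, $\theta_t:\hat{\mathcal X}'_t=\sigma_t'(\mathcal H_t)\to\mathcal X_t$, associated with this factorization. If, in addition, $h_t\odot_t h_t'$ implies $\sigma_t'(h_t)=\sigma_t'(h_t')$ for every $t\in[T+1]$ (and all $h_t,h_t'\in\mathcal H_t$), then each $\theta_t:\hat{\mathcal X}'_t\to\mathcal X_t$ is a homeomorphism.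
   Context: **Primitives.** For an integer $n\ge 0$, $[n]=\{0,1,\dots,n\}$. $T\ge 1$ is an integer horizon. $\mathcal S$ is a finite nonempty set (discrete topology); $\mathcal S_0=\{\bar s_0\}$ is a singleton, $\mathcal S_t=\mathcal S$ for $1\le t\le T$, $\mathcal S_{T+1}=\{\star\}$. $\mathcal C=[0,\bar c]\subset\mathbb R_{\ge 0}$ is a compact interval. Histories: $\mathcal H_0=\{\bar s_0\}$, $\mathcal H_t=\mathcal H_{t-1}\times\mathcal C\times\mathcal S_t$ for $1\le t\le T$, $\mathcal H_{T+1}=\mathcal H_T\times\mathcal C$, with product topologies (compact metrizable). Extension maps $\iota_t:\mathcal H_t\times\mathcal C\times\mathcal S_{t+1}\to\mathcal H_{t+1}$: $\iota_t(h_t,c,s)=(h_t,c,s)$ for $t\in[T-1]$, $\iota_T(h_T,c,\star)=(h_T,c)$. Physical-state projections $\sigma^s_t:\mathcal H_t\to\mathcal S_t$: $\sigma_t^s(h_t)$ is the last state $s_t$ of $h_t$ for $t\in[T]$, and $\sigma^s_{T+1}\equiv\star$. Plans: $\mathcal F_{T+1}=\{\emptyset\}$ and $\mathcal F_t=\mathcal C\times(\mathcal F_{t+1})^{\mathcal S}$ for $t\in[T]$ (product topology); $\mathcal F_T$ is identified with $\mathcal C$. For $t\in[T-1]$ a plan is written $f=(c,f_+)$ with $c\in\mathcal C$, $f_+:\mathcal S\to\mathcal F_{t+1}$. $\mathcal L=\mathbb R^{\mathcal S}$ with sup norm and pointwise order; $\mathbf v\in\mathcal L$ is the constant vector with value $v$.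 **Preferences.** A grand preference is $\mathcal P=(\{\succeq_{(t)}\}_{t=0}^T,V_{T+1})$ with $\succeq_{(t)}$ a binary relation on $\mathcal H_t\times\mathcal F_t$ and $V_{T+1}:\mathcal H_{T+1}\to\mathbb R$ continuous; $\sim_{(t)}$ is indifference. A utility system is $\mathbf U=\{U_t\}_{t=0}^{T+1}$ with $U_t:\mathcal H_t\times\mathcal F_t\to\mathbb R$ ($t\in[T]$) and $U_{T+1}:\mathcal H_{T+1}\to\mathbb R$ continuous. It is compatible with $\mathcal P$ if $U_{T+1}=V_{T+1}$; $U_T(h_T,c)=U_{T+1}(\iota_T(h_T,c,\star))$; and for all $t\in[T]$, $U_t(h_t,f)\ge U_t(h_t',g)\iff(h_t,f)\succeq_{(t)}(h_t',g)$. **PA-state systems.** A PA-state system is $\mathfrak X=(\{\mathcal X_t\}_{t=0}^{T+1},\{\varsigma_t\}_{t=0}^{T+1},\{\Gamma_t\}_{t=0}^{T})$ with $\mathcal X_t$ nonempty compact metrizable, $\varsigma_t:\mathcal X_t\to\mathcal S_t$ continuous, and $\Gamma_t:\mathcal X_t\times\mathcal C\times\mathcal S_{t+1}\to\mathcal X_{t+1}$ continuous with $\varsigma_{t+1}(\Gamma_t(x,c,s'))=s'$. A PA recursive structure on $\mathfrak X$ is $(\{W_t\}_{t=0}^{T-1},\{M_t\}_{t=0}^{T-1},V)$ where $W_t:\mathcal X_t\times\mathcal C\times\mathbb R\to\mathbb R$ is jointly continuous and nondecreasing in its last argument; $M_t:\mathcal X_t\times\mathcal L\to\mathbb R$ is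 jointly continuous, monotone in $\tilde u\in\mathcal L$, with $M_t(x,\mathbf v)=v$ for all $x$, $v\in\mathbb R$; $V:\mathcal X_{T+1}\to\mathbb R$ is continuous. Here $\mathcal V'=(\{W'_t\},\{M'_t\},V'_{T+1})$, and $(\mathfrak X',\mathcal V')$ generates utilities $\{U'_t\}$: $U'_{T+1}=V'_{T+1}$, $U'_T(x,c)=U'_{T+1}(\Gamma'_T(x,c,\star))$, and for $t\in[T-1]$, $f=(c,f_+)$, $U'_t(x,f)=W'_t(x,c,M'_t(x,\tilde u'))$ with $\tilde u'(s)=U'_{t+1}(\Gamma'_t(x,c,s),f_+(s))$. **Factorization.** $(\mathfrak X',\mathcal V')$ factorizes $\mathbf U$ through $\{\sigma'_t\}$ if $\sigma'_t:\mathcal H_t\to\mathcal X'_t$ are continuous with $\varsigma'_t\circ\sigma'_t=\sigma_t^s$ ($t\in[T+1]$), $U_{T+1}=U'_{T+1}\circ\sigma'_{T+1}$, $U_t(h_t,f)=U'_t(\sigma'_t(h_t),f)$ for all $h_t,f$, $t\in[T]$, and $\sigma'_{t+1}(\iota_t(h_t,c,s))=\Gamma'_t(\sigma'_t(h_t),c,s)$ for all $h_t,c,s\in\mathcal S_{t+1}$, $t\in[T]$. **Canonical PA-state system.** Define: $h_{T+1}\odot_{T+1}h'_{T+1}$ iff $U_{T+1}(h_{T+1})=U_{T+1}(h_{T+1}')$; for $t\in[T]$, $h_t\odot_th_t'$ iff (i) $\sigma_t^s(h_t)=\sigma_t^s(h'_t)$, (ii) $(h_t,f)\sim_{(t)}(h_t',f)$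 for all $f\in\mathcal F_t$, and (iii) $\iota_t(h_t,c,s)\odot_{t+1}\iota_t(h_t',c,s)$ for all $c\in\mathcal C$, $s\in\mathcal S_{t+1}$. These are equivalence relations. The canonical system $\mathfrak X^*$ consists of $\mathcal X_t=\mathcal H_t/\odot_t$ (quotient topology, canonical projection $\sigma_t$), $\varsigma_t$ with $\varsigma_t\circ\sigma_t=\sigma_t^s$, and $\Gamma_t$ with $\Gamma_t(\sigma_t(h_t),c,s')=\sigma_{t+1}(\iota_t(h_t,c,s'))$; these are well defined and form a PA-state system. Quotient utilities (well defined and continuous): $U^\circ_{T+1}(\sigma_{T+1}(h_{T+1}))=U_{T+1}(h_{T+1})$, $U_t^\circ(\sigma_t(h_t),f)=U_t(h_t,f)$, $t\in[T]$. **Memory correspondence.** With $\hat{\mathcal X}'_t=\sigma'_t(\mathcal H_t)$ (subspace topology), a memory correspondence is a collection of continuous maps $\theta_t:\hat{\mathcal X}_t'\to\mathcal X_t$, $t\in[T+1]$, such that: (1) $\theta_t\circ\sigma_t'=\sigma_t$ for all $t\in[T+1]$; (2) $\Gamma'_t(x',c,s)\in\hat{\mathcal X}'_{t+1}$ and $\theta_{t+1}(\Gamma_t'(x',c,s))=\Gamma_t(\theta_t(x'),c,s)$ for all $x'\in\hat{\mathcal X}'_t$, $c\in\mathcal C$, $s\in\mathcal S_{t+1}$, $t\in[T]$; (3) $U'_t(x',f)=U_t^\circ(\theta_t(x'),f)$ for all $x'\in\hat{\mathcal X}'_t$, $f\in\mathcal F_t$, $t\in[T]$, and $U'_{T+1}(x')=U^\circ_{T+1}(\theta_{T+1}(x'))$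 for all $x'\in\hat{\mathcal X}'_{T+1}$. *)

theory Defs
  imports "HOL-Analysis.Analysis"
begin

section \<open>Primitives\<close>

record 's env =
  horizon :: nat
  states :: "'s set"
  init_state :: 's
  final_state :: 's
  cmax :: real

definition is_env :: "'s env \<Rightarrow> bool" where
  "is_env E \<longleftrightarrow> 1 \<le> horizon E \<and> finite (states E) \<and> states E \<noteq> {} \<and> 0 \<le> cmax E"

definition St :: "'s env \<Rightarrow> nat \<Rightarrow> 's set" where
  "St E t = (if t = 0 then {init_state E}
             else if t \<le> horizon E then states E
             else {final_state E})"

definition C :: "'s env \<Rightarrow> real set" where
  "C E = {0..cmax E}"

definition Ctop :: "'s env \<Rightarrow> real topology" where
  "Ctop E = top_of_set (C E)"

subsection \<open>Histories\<close>

datatype 's hist =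
    is_Start: Start (start_state: 's)
  | is_Step: Step (step_prev: "'s hist") (step_cons: real) (step_state: 's)
  | is_Final: Final (final_prev: "'s hist") (final_cons: real)

text \<open>The pullback along the bijective destructor of a constructor makes that constructor a
  homeomorphism from the product space.\<close>

primrec Htop :: "'s env \<Rightarrow> nat \<Rightarrow> 's hist topology" where
  "Htop E 0 = discrete_topology {Start (init_state E)}"
| "Htop E (Suc t) =
    (if t < horizon E
     then pullback_topology {h. is_Step h} (\<lambda>h. (step_prev h, step_cons h, step_state h))
            (prod_topology (Htop E t)
               (prod_topology (Ctop E) (discrete_topology (St E (Suc t)))))
     else pullback_topology {h. is_Final h} (\<lambda>h. (final_prev h, final_cons h))
            (prod_topology (Htop E t) (Ctop E)))"

definition H :: "'s env \<Rightarrow> nat \<Rightarrow> 's hist set" where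
  "H E t = topspace (Htop E t)"

definition ext :: "'s env \<Rightarrow> nat \<Rightarrow> 's hist \<Rightarrow> real \<Rightarrow> 's \<Rightarrow> 's hist" where
  "ext E t h c s = (if t < horizon E then Step h c s else Final h c)"

definition phys :: "'s env \<Rightarrow> nat \<Rightarrow> 's hist \<Rightarrow> 's" where
  "phys E t h = (if t \<le> horizon E
                 then (case h of Start s \<Rightarrow> s | Step _ _ s \<Rightarrow> s | Final _ _ \<Rightarrow> undefined)
                 else final_state E)"

lemma H_Suc:
  "t < horizon E \<Longrightarrow> H E (Suc t) = {Step h c s | h c s. h \<in> H E t \<and> c \<in> C E \<and> s \<in> St E (Suc t)}"
  "H E (Suc (horizon E)) = {Final h c | h c. h \<in> H E (horizon E) \<and> c \<in> C E}"
  by (auto simp: H_def topspace_pullback_topology Ctop_def is_Step_def is_Final_def)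

lemma ext_mem:
  assumes "t \<le> horizon E" "h \<in> H E t" "c \<in> C E" "s \<in> St E (Suc t)"
  shows "ext E t h c s \<in> H E (Suc t)"
  using assms by (auto simp: ext_def H_def topspace_pullback_topology Ctop_def)

subsection \<open>Plans\<close>

datatype 's plan =
    Null
  | is_Plan: Plan (now: real) (later: "'s \<Rightarrow> 's plan")

text \<open>Plans with \<open>n\<close> remaining consumption dates. At the horizon a plan has the form
  \<open>Plan c (\<lambda>s\<in>states E. Null)\<close> and is identified with the consumption level \<open>c\<close>.\<close>

primrec plan_top :: "'s env \<Rightarrow> nat \<Rightarrow> 's plan topology" where
  "plan_top E 0 = discrete_topology {Null}"
| "plan_top E (Suc n) =
    pullback_topology {f. is_Plan f} (\<lambda>f. (now f, later f))
      (prod_topology (Ctop E) (product_topology (\<lambda>_. plan_top E n) (states E)))"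

definition Ftop :: "'s env \<Rightarrow> nat \<Rightarrow> 's plan topology" where
  "Ftop E t = plan_top E (Suc (horizon E) - t)"

definition F :: "'s env \<Rightarrow> nat \<Rightarrow> 's plan set" where
  "F E t = topspace (Ftop E t)"

lemma F_eq:
  "t \<le> horizon E \<Longrightarrow> F E t = {Plan c k | c k. c \<in> C E \<and> k \<in> states E \<rightarrow>\<^sub>E F E (Suc t)}"
  "F E (Suc (horizon E)) = {Null}"
  by (auto simp: F_def Ftop_def Suc_diff_le topspace_pullback_topology Ctop_def is_Plan_def)

subsection \<open>Continuation vectors\<close>

definition L :: "'s env \<Rightarrow> ('s \<Rightarrow> real) set" where
  "L E = states E \<rightarrow>\<^sub>E UNIV"

definition Ltop :: "'s env \<Rightarrow> ('s \<Rightarrow> real) topology" where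
  "Ltop E = Metric_space.mtopology (L E) (\<lambda>u v. SUP s\<in>states E. \<bar>u s - v s\<bar>)"

section \<open>Preferences and utility systems\<close>

record 's grand_pref =
  pref :: "nat \<Rightarrow> (('s hist \<times> 's plan) \<times> ('s hist \<times> 's plan)) set"
  pref_end :: "'s hist \<Rightarrow> real"

definition grand_preference :: "'s env \<Rightarrow> 's grand_pref \<Rightarrow> bool" where
  "grand_preference E P \<longleftrightarrow>
     (\<forall>t\<le>horizon E. pref P t \<subseteq> (H E t \<times> F E t) \<times> (H E t \<times> F E t)) \<and>
     continuous_map (Htop E (Suc (horizon E))) euclideanreal (pref_end P)"

definition indiff :: "'s grand_pref \<Rightarrow> nat \<Rightarrow> 's hist \<times> 's plan \<Rightarrow> 's hist \<times> 's plan \<Rightarrow> bool" where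
  "indiff P t a b \<longleftrightarrow> (a, b) \<in> pref P t \<and> (b, a) \<in> pref P t"

record 's utils =
  util :: "nat \<Rightarrow> 's hist \<Rightarrow> 's plan \<Rightarrow> real"
  util_end :: "'s hist \<Rightarrow> real"

definition utility_system :: "'s env \<Rightarrow> 's utils \<Rightarrow> bool" where
  "utility_system E U \<longleftrightarrow>
     (\<forall>t\<le>horizon E. continuous_map (prod_topology (Htop E t) (Ftop E t)) euclideanreal
                       (\<lambda>(h, f). util U t h f)) \<and>
     continuous_map (Htop E (Suc (horizon E))) euclideanreal (util_end U)"

definition compatible :: "'s env \<Rightarrow> 's grand_pref \<Rightarrow> 's utils \<Rightarrow> bool" where
  "compatible E P U \<longleftrightarrow>
     (\<forall>h\<in>H E (Suc (horizon E)). util_end U h = pref_end P h) \<and>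
     (\<forall>h\<in>H E (horizon E). \<forall>f\<in>F E (horizon E).
        util U (horizon E) h f = util_end U (ext E (horizon E) h (now f) (final_state E))) \<and>
     (\<forall>t\<le>horizon E. \<forall>h\<in>H E t. \<forall>f\<in>F E t. \<forall>h'\<in>H E t. \<forall>g\<in>F E t.
        util U t h f \<ge> util U t h' g \<longleftrightarrow> ((h, f), (h', g)) \<in> pref P t)"

section \<open>PA-state systems and PA recursive structures\<close>

record ('s, 'x) pa_system =
  pa_top :: "nat \<Rightarrow> 'x topology"
  pa_phys :: "nat \<Rightarrow> 'x \<Rightarrow> 's"
  pa_trans :: "nat \<Rightarrow> 'x \<Rightarrow> real \<Rightarrow> 's \<Rightarrow> 'x"

definition pa_state_system :: "'s env \<Rightarrow> ('s, 'x) pa_system \<Rightarrow> bool" where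
  "pa_state_system E X \<longleftrightarrow>
     (\<forall>t\<le>Suc (horizon E).
        topspace (pa_top X t) \<noteq> {} \<and> compact_space (pa_top X t) \<and> metrizable_space (pa_top X t) \<and>
        continuous_map (pa_top X t) (discrete_topology (St E t)) (pa_phys X t)) \<and>
     (\<forall>t\<le>horizon E.
        continuous_map
          (prod_topology (pa_top X t)
             (prod_topology (Ctop E) (discrete_topology (St E (Suc t)))))
          (pa_top X (Suc t)) (\<lambda>(x, c, s). pa_trans X t x c s) \<and>
        (\<forall>x\<in>topspace (pa_top X t). \<forall>c\<in>C E. \<forall>s\<in>St E (Suc t).
           pa_phys X (Suc t) (pa_trans X t x c s) = s))"

record ('s, 'x) pa_struct =
  aggr :: "nat \<Rightarrow> 'x \<Rightarrow> real \<Rightarrow> real \<Rightarrow> real"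
  cert :: "nat \<Rightarrow> 'x \<Rightarrow> ('s \<Rightarrow> real) \<Rightarrow> real"
  term_val :: "'x \<Rightarrow> real"

definition pa_recursive_structure ::
  "'s env \<Rightarrow> ('s, 'x) pa_system \<Rightarrow> ('s, 'x) pa_struct \<Rightarrow> bool" where
  "pa_recursive_structure E X V \<longleftrightarrow>
     (\<forall>t<horizon E.
        continuous_map (prod_topology (pa_top X t) (prod_topology (Ctop E) euclideanreal))
          euclideanreal (\<lambda>(x, c, y). aggr V t x c y) \<and>
        (\<forall>x\<in>topspace (pa_top X t). \<forall>c\<in>C E. mono (aggr V t x c)) \<and>
        continuous_map (prod_topology (pa_top X t) (Ltop E)) euclideanreal
          (\<lambda>(x, u). cert V t x u) \<and>
        (\<forall>x\<in>topspace (pa_top X t). \<forall>u\<in>L E. \<forall>v\<in>L E.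
           (\<forall>s\<in>states E. u s \<le> v s) \<longrightarrow> cert V t x u \<le> cert V t x v) \<and>
        (\<forall>x\<in>topspace (pa_top X t). \<forall>v. cert V t x (\<lambda>s\<in>states E. v) = v)) \<and>
     continuous_map (pa_top X (Suc (horizon E))) euclideanreal (term_val V)"

text \<open>The generated utilities at the dates \<open>t \<le> horizon E\<close>; the generated utility at
  \<open>Suc (horizon E)\<close> is \<open>term_val V\<close>.\<close>

function gen_util ::
  "'s env \<Rightarrow> ('s, 'x) pa_system \<Rightarrow> ('s, 'x) pa_struct \<Rightarrow> nat \<Rightarrow> 'x \<Rightarrow> 's plan \<Rightarrow> real" where
  "gen_util E X V t x f =
     (if t < horizon E
      then aggr V t x (now f)
             (cert V t x
               (\<lambda>s\<in>states E. gen_util E X V (Suc t) (pa_trans X t x (now f) s) (later f s)))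
      else term_val V (pa_trans X t x (now f) (final_state E)))"
  by pat_completeness auto
termination
  by (relation "Wellfounded.measure (\<lambda>(E, X, V, t, x, f). horizon E - t)") auto

declare gen_util.simps [simp del]

definition factorizes ::
  "'s env \<Rightarrow> 's utils \<Rightarrow> ('s, 'x) pa_system \<Rightarrow> ('s, 'x) pa_struct \<Rightarrow> (nat \<Rightarrow> 's hist \<Rightarrow> 'x) \<Rightarrow> bool"
  where
  "factorizes E U X V \<sigma> \<longleftrightarrow>
     (\<forall>t\<le>Suc (horizon E).
        continuous_map (Htop E t) (pa_top X t) (\<sigma> t) \<and>
        (\<forall>h\<in>H E t. pa_phys X t (\<sigma> t h) = phys E t h)) \<and>
     (\<forall>h\<in>H E (Suc (horizon E)). util_end U h = term_val V (\<sigma> (Suc (horizon E)) h)) \<and>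
     (\<forall>t\<le>horizon E. \<forall>h\<in>H E t. \<forall>f\<in>F E t. util U t h f = gen_util E X V t (\<sigma> t h) f) \<and>
     (\<forall>t\<le>horizon E. \<forall>h\<in>H E t. \<forall>c\<in>C E. \<forall>s\<in>St E (Suc t).
        \<sigma> (Suc t) (ext E t h c s) = pa_trans X t (\<sigma> t h) c s)"

section \<open>The canonical PA-state system\<close>

function odot :: "'s env \<Rightarrow> 's grand_pref \<Rightarrow> 's utils \<Rightarrow> nat \<Rightarrow> 's hist \<Rightarrow> 's hist \<Rightarrow> bool" where
  "odot E P U t h h' \<longleftrightarrow>
     (if t \<le> horizon E
      then phys E t h = phys E t h' \<and>
           (\<forall>f\<in>F E t. indiff P t (h, f) (h', f)) \<and>
           (\<forall>c\<in>C E. \<forall>s\<in>St E (Suc t). odot E P U (Suc t) (ext E t h c s) (ext E t h' c s))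
      else util_end U h = util_end U h')"
  by pat_completeness auto
termination
  by (relation "Wellfounded.measure (\<lambda>(E, P, U, t, h, h'). Suc (horizon E) - t)") auto

declare odot.simps [simp del]

definition odot_equiv :: "'s env \<Rightarrow> 's grand_pref \<Rightarrow> 's utils \<Rightarrow> nat \<Rightarrow> 's hist rel" where
  "odot_equiv E P U t = {(h, h'). h \<in> H E t \<and> h' \<in> H E t \<and> odot E P U t h h'}"

definition quotient_topology :: "'a topology \<Rightarrow> 'a rel \<Rightarrow> 'a set topology" where
  "quotient_topology X r = topology (\<lambda>W. W \<subseteq> topspace X // r \<and> openin X (\<Union>W))"

lemma openin_quotient_topology:
  assumes r: "equiv (topspace X) r"
  shows "openin (quotient_topology X r) W \<longleftrightarrow> W \<subseteq> topspace X // r \<and> openin X (\<Union>W)"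
proof -
  have "istopology (\<lambda>W. W \<subseteq> topspace X // r \<and> openin X (\<Union>W))"
    unfolding istopology_def
  proof (intro conjI allI impI)
    fix A B assume A: "A \<subseteq> topspace X // r \<and> openin X (\<Union>A)" and B: "B \<subseteq> topspace X // r \<and> openin X (\<Union>B)"
    show "A \<inter> B \<subseteq> topspace X // r" using A by blast
    have "\<Union>(A \<inter> B) = \<Union>A \<inter> \<Union>B"
    proof
      show "\<Union>A \<inter> \<Union>B \<subseteq> \<Union>(A \<inter> B)"
      proof
        fix z assume "z \<in> \<Union>A \<inter> \<Union>B"
        then obtain a b where "a \<in> A" "b \<in> B" "z \<in> a" "z \<in> b" by blast
        with quotient_disj[OF r, of a b] A B show "z \<in> \<Union>(A \<inter> B)" by blast
      qed
    qed auto
    then show "openin X (\<Union>(A \<inter> B))" using A B by auto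
  next
    fix K assume K: "\<forall>W\<in>K. W \<subseteq> topspace X // r \<and> openin X (\<Union>W)"
    then show "\<Union>K \<subseteq> topspace X // r" by blast
    have "\<Union>(\<Union>K) = \<Union>(Union ` K)" by blast
    then show "openin X (\<Union>(\<Union>K))" using K by auto
  qed
  then show ?thesis unfolding quotient_topology_def by simp
qed

lemma topspace_quotient_topology:
  assumes r: "equiv (topspace X) r"
  shows "topspace (quotient_topology X r) = topspace X // r"
proof
  show "topspace (quotient_topology X r) \<subseteq> topspace X // r"
    by (metis openin_quotient_topology[OF r] openin_topspace)
  have "openin (quotient_topology X r) (topspace X // r)"
    using Union_quotient[OF r] by (simp add: openin_quotient_topology[OF r])
  then show "topspace X // r \<subseteq> topspace (quotient_topology X r)" by (rule openin_subset)
qed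

lemma quotient_map_quotient_topology:
  assumes r: "equiv (topspace X) r"
  shows "quotient_map X (quotient_topology X r) (\<lambda>x. r `` {x})"
  unfolding quotient_map_def
proof (intro conjI allI impI)
  show "(\<lambda>x. r `` {x}) ` topspace X = topspace (quotient_topology X r)"
    unfolding topspace_quotient_topology[OF r] quotient_def by auto
  fix W assume W: "W \<subseteq> topspace (quotient_topology X r)"
  then have W': "W \<subseteq> topspace X // r" unfolding topspace_quotient_topology[OF r] .
  have "{x \<in> topspace X. r `` {x} \<in> W} = \<Union>W"
  proof (intro set_eqI iffI)
    fix x assume "x \<in> {x \<in> topspace X. r `` {x} \<in> W}"
    then show "x \<in> \<Union>W" using equiv_class_self[OF r] by blast
  next
    fix x assume "x \<in> \<Union>W"
    then obtain w where w: "w \<in> W" "x \<in> w" by blast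
    then have q: "w \<in> topspace X // r" using W' by blast
    then have "x \<in> topspace X" using w Union_quotient[OF r] by blast
    then have "r `` {x} \<in> topspace X // r" by (rule quotientI)
    then have "r `` {x} = w" using quotient_disj[OF r q] w equiv_class_self[OF r \<open>x \<in> topspace X\<close>] by blast
    then show "x \<in> {x \<in> topspace X. r `` {x} \<in> W}" using w \<open>x \<in> topspace X\<close> by blast
  qed
  then show "openin X {x \<in> topspace X. r `` {x} \<in> W} = openin (quotient_topology X r) W"
    using W' by (simp add: openin_quotient_topology[OF r])
qed

definition canon_proj ::
  "'s env \<Rightarrow> 's grand_pref \<Rightarrow> 's utils \<Rightarrow> nat \<Rightarrow> 's hist \<Rightarrow> 's hist set" where
  "canon_proj E P U t h = odot_equiv E P U t `` {h}"

text \<open>Maps on equivalence classes are given by \<^const>\<open>the_elem\<close> of an image, which is the common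
  value whenever the underlying map is constant on the class.\<close>

definition canonical_system ::
  "'s env \<Rightarrow> 's grand_pref \<Rightarrow> 's utils \<Rightarrow> ('s, 's hist set) pa_system" where
  "canonical_system E P U =
     \<lparr> pa_top = (\<lambda>t. quotient_topology (Htop E t) (odot_equiv E P U t)),
       pa_phys = (\<lambda>t x. the_elem (phys E t ` x)),
       pa_trans = (\<lambda>t x c s. the_elem ((\<lambda>h. canon_proj E P U (Suc t) (ext E t h c s)) ` x)) \<rparr>"

definition quot_util :: "'s utils \<Rightarrow> nat \<Rightarrow> 's hist set \<Rightarrow> 's plan \<Rightarrow> real" where
  "quot_util U t x f = the_elem ((\<lambda>h. util U t h f) ` x)"

definition quot_util_end :: "'s utils \<Rightarrow> 's hist set \<Rightarrow> real" where
  "quot_util_end U x = the_elem (util_end U ` x)"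

context
  fixes E :: "'s env" and P U
  assumes c: "compatible E P U"
begin

lemma indiff_iff:
  "\<lbrakk>t \<le> horizon E; h \<in> H E t; h' \<in> H E t; f \<in> F E t\<rbrakk> \<Longrightarrow> indiff P t (h,f) (h',f) \<longleftrightarrow> util U t h f = util U t h' f"
  using c unfolding compatible_def indiff_def by (metis order_antisym order_refl)

lemma equiv_odot_equiv: "t \<le> Suc (horizon E) \<Longrightarrow> equiv (H E t) (odot_equiv E P U t)"
proof (induction t rule: inc_induct)
  case base
  show ?case by (auto simp: equiv_def refl_on_def sym_def trans_def odot_equiv_def odot.simps)
next
  case (step t)
  then have t: "t \<le> horizon E" by simp
  have *: "odot_equiv E P U t = {(h,h'). h \<in> H E t \<and> h' \<in> H E t \<and> phys E t h = phys E t h' \<and>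
     (\<forall>f\<in>F E t. util U t h f = util U t h' f) \<and>
     (\<forall>c\<in>C E. \<forall>s\<in>St E (Suc t). (ext E t h c s, ext E t h' c s) \<in> odot_equiv E P U (Suc t))}"
    unfolding odot_equiv_def using t by (subst odot.simps) (auto simp: indiff_iff ext_mem)
  have r: "(x, x) \<in> odot_equiv E P U (Suc t)" if "x \<in> H E (Suc t)" for x
    using step.IH that by (auto simp: equiv_def refl_on_def)
  have sy: "(y, x) \<in> odot_equiv E P U (Suc t)" if "(x, y) \<in> odot_equiv E P U (Suc t)" for x y
    using step.IH that unfolding equiv_def sym_def by blast
  have tr: "(x, z) \<in> odot_equiv E P U (Suc t)" if "(x, y) \<in> odot_equiv E P U (Suc t)" "(y, z) \<in> odot_equiv E P U (Suc t)" for x y z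
    using step.IH that unfolding equiv_def trans_def by blast
  show ?case
  proof (rule equivI)
    show "odot_equiv E P U t \<subseteq> H E t \<times> H E t" by (auto simp: odot_equiv_def)
    show "refl_on (H E t) (odot_equiv E P U t)"
      unfolding * refl_on_def using r ext_mem[OF t] by simp
    show "sym (odot_equiv E P U t)" unfolding * sym_def using sy by simp
    show "trans (odot_equiv E P U t)" unfolding * trans_def using tr by simp blast
  qed
qed

lemma the_elem_class:
  assumes "t \<le> Suc (horizon E)" "h \<in> H E t" "\<And>h'. h' \<in> H E t \<Longrightarrow> odot E P U t h h' \<Longrightarrow> g h' = g h"
  shows "the_elem (g ` canon_proj E P U t h) = g h"
proof -
  have "h \<in> canon_proj E P U t h" using equiv_class_self[OF equiv_odot_equiv[OF assms(1)] assms(2)] by (simp add: canon_proj_def)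
  then have "g ` canon_proj E P U t h = {g h}" using assms(3) unfolding canon_proj_def odot_equiv_def by blast
  then show ?thesis by simp
qed

lemma canon_eq:
  assumes "t \<le> Suc (horizon E)" "h \<in> H E t" "h' \<in> H E t"
  shows "canon_proj E P U t h = canon_proj E P U t h' \<longleftrightarrow> odot E P U t h h'"
  using eq_equiv_class_iff[OF equiv_odot_equiv[OF assms(1)] assms(2,3)] assms by (simp add: canon_proj_def odot_equiv_def)

lemma canon_phys:
  assumes "t \<le> Suc (horizon E)" "h \<in> H E t"
  shows "pa_phys (canonical_system E P U) t (canon_proj E P U t h) = phys E t h"
proof -
  have "the_elem (phys E t ` canon_proj E P U t h) = phys E t h"
  proof (rule the_elem_class[OF assms])
    fix h' assume "odot E P U t h h'"
    then show "phys E t h' = phys E t h"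
      by (subst (asm) odot.simps) (auto simp: phys_def split: if_splits)
  qed
  then show ?thesis by (simp add: canonical_system_def)
qed

lemma canon_trans:
  assumes "t \<le> horizon E" "h \<in> H E t" "c \<in> C E" "s \<in> St E (Suc t)"
  shows "pa_trans (canonical_system E P U) t (canon_proj E P U t h) c s = canon_proj E P U (Suc t) (ext E t h c s)"
proof -
  have "the_elem ((\<lambda>h. canon_proj E P U (Suc t) (ext E t h c s)) ` canon_proj E P U t h) = canon_proj E P U (Suc t) (ext E t h c s)"
  proof (rule the_elem_class)
    fix h' assume h': "h' \<in> H E t" "odot E P U t h h'"
    then have "odot E P U (Suc t) (ext E t h c s) (ext E t h' c s)"
      using assms by (subst (asm) odot.simps) auto
    then show "canon_proj E P U (Suc t) (ext E t h' c s) = canon_proj E P U (Suc t) (ext E t h c s)"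
      using canon_eq[of "Suc t" "ext E t h c s" "ext E t h' c s"] assms h' ext_mem by (metis Suc_le_mono)
  qed (use assms in auto)
  then show ?thesis by (simp add: canonical_system_def)
qed

lemma quot_util_eq:
  assumes "t \<le> horizon E" "h \<in> H E t" "f \<in> F E t"
  shows "quot_util U t (canon_proj E P U t h) f = util U t h f"
  unfolding quot_util_def
proof (rule the_elem_class)
  fix h' assume "h' \<in> H E t" "odot E P U t h h'"
  then show "util U t h' f = util U t h f"
    using assms indiff_iff by (subst (asm) odot.simps) auto
qed (use assms in auto)

lemma quot_util_end_eq:
  assumes "h \<in> H E (Suc (horizon E))"
  shows "quot_util_end U (canon_proj E P U (Suc (horizon E)) h) = util_end U h"
  unfolding quot_util_end_def
proof (rule the_elem_class)
  fix h' assume "odot E P U (Suc (horizon E)) h h'"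
  then show "util_end U h' = util_end U h" by (subst (asm) odot.simps) simp
qed (use assms in auto)

lemma canon_quotient_map:
  assumes "t \<le> Suc (horizon E)"
  shows "quotient_map (Htop E t) (pa_top (canonical_system E P U) t) (canon_proj E P U t)"
  using quotient_map_quotient_topology[of "Htop E t" "odot_equiv E P U t"] equiv_odot_equiv[OF assms]
  by (simp add: canonical_system_def canon_proj_def[abs_def] H_def)

end

section \<open>Memory correspondences\<close>

definition reach_top ::
  "'s env \<Rightarrow> ('s, 'x) pa_system \<Rightarrow> (nat \<Rightarrow> 's hist \<Rightarrow> 'x) \<Rightarrow> nat \<Rightarrow> 'x topology" where
  "reach_top E X \<sigma> t = subtopology (pa_top X t) (\<sigma> t ` H E t)"

text \<open>The families \<open>\<theta>\<close> and their members are extensional, so that equality of memory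
  correspondences in HOL is equality on the dates up to \<open>Suc (horizon E)\<close> and on the
  domains \<open>\<sigma> t ` H E t\<close>.\<close>

definition memory_correspondence ::
  "'s env \<Rightarrow> 's grand_pref \<Rightarrow> 's utils \<Rightarrow> ('s, 'x) pa_system \<Rightarrow> ('s, 'x) pa_struct \<Rightarrow>
   (nat \<Rightarrow> 's hist \<Rightarrow> 'x) \<Rightarrow> (nat \<Rightarrow> 'x \<Rightarrow> 's hist set) \<Rightarrow> bool" where
  "memory_correspondence E P U X V \<sigma> \<theta> \<longleftrightarrow>
     (let T = horizon E; K = canonical_system E P U in
     \<theta> \<in> extensional {..Suc T} \<and>
     (\<forall>t\<le>Suc T.
        \<theta> t \<in> extensional (\<sigma> t ` H E t) \<and>
        continuous_map (reach_top E X \<sigma> t) (pa_top K t) (\<theta> t) \<and>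
        (\<forall>h\<in>H E t. \<theta> t (\<sigma> t h) = canon_proj E P U t h)) \<and>
     (\<forall>t\<le>T. \<forall>x\<in>\<sigma> t ` H E t. \<forall>c\<in>C E. \<forall>s\<in>St E (Suc t).
        pa_trans X t x c s \<in> \<sigma> (Suc t) ` H E (Suc t) \<and>
        \<theta> (Suc t) (pa_trans X t x c s) = pa_trans K t (\<theta> t x) c s) \<and>
     (\<forall>t\<le>T. \<forall>x\<in>\<sigma> t ` H E t. \<forall>f\<in>F E t.
        gen_util E X V t x f = quot_util U t (\<theta> t x) f) \<and>
     (\<forall>x\<in>\<sigma> (Suc T) ` H E (Suc T). term_val V x = quot_util_end U (\<theta> (Suc T) x)))"

end

theory Submission
  imports Defs
begin

text \<open>Equality of summaries \<open>\<sigma>' t h = \<sigma>' t h'\<close> forces \<open>odot\<close>-equivalence, by backward induction on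
  the date: the summaries determine the physical state, the utilities, and the summaries of all
  one-step extensions. Hence the canonical projection factors uniquely through \<open>\<sigma>'\<close>. Histories form
  a compact space and the summaries live in a Hausdorff one, so \<open>\<sigma>'\<close> is a quotient map onto its
  image, which makes the factor map continuous, and a homeomorphism as soon as it is injective.\<close>

text \<open>Since \<open>f \<circ> g\<close> is the identity on \<open>Y\<close>, the section
  \<open>g\<close> is continuous into the pullback. Its image is the whole pullback space, so
  compactness passes along \<open>g\<close>.\<close>

lemma compact_space_pullback_topology:
  assumes "compact_space Y"
    and section_mem: "\<And>y. y \<in> topspace Y \<Longrightarrow> g y \<in> A"
    and right_inv: "\<And>y. y \<in> topspace Y \<Longrightarrow> f (g y) = y"
    and left_inv: "\<And>x. x \<in> A \<Longrightarrow> g (f x) = x"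
  shows "compact_space (pullback_topology A f Y)"
proof -
  have "continuous_map Y Y (f \<circ> g)"
    by (rule continuous_map_eq[OF continuous_map_id]) (simp add: right_inv)
  then have "continuous_map Y (pullback_topology A f Y) g"
    by (rule continuous_map_pullback') (use section_mem in auto)
  then have "compactin (pullback_topology A f Y) (g ` topspace Y)"
    using assms(1) image_compactin unfolding compact_space_def by blast
  moreover have "g ` topspace Y = topspace (pullback_topology A f Y)"
    using section_mem right_inv left_inv by (force simp: topspace_pullback_topology)
  ultimately show ?thesis
    by (simp add: compact_space_def)
qed

lemma compact_space_Htop:
  assumes "is_env E"
  shows "compact_space (Htop E t)"
proof (induction t)
  case 0
  show ?case by (simp add: compact_space_discrete_topology)
next
  case (Suc t)
  have C: "compact_space (Ctop E)"
    by (simp add: Ctop_def C_def compact_space_subtopology)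
  \<comment> \<open>Every \<open>St E (Suc t)\<close> is finite: either \<open>states E\<close> or a
    singleton.\<close>
  have S: "compact_space (discrete_topology (St E (Suc t)))"
    using assms by (simp add: compact_space_discrete_topology St_def is_env_def)
  show ?case
  proof (cases "t < horizon E")
    case True
    \<comment> \<open>The section is the constructor itself, which inverts the destructors.\<close>
    have "compact_space (pullback_topology {h. is_Step h}
        (\<lambda>h. (step_prev h, step_cons h, step_state h))
        (prod_topology (Htop E t) (prod_topology (Ctop E) (discrete_topology (St E (Suc t))))))"
      by (rule compact_space_pullback_topology[where g = "\<lambda>(h, c, s). Step h c s"])
        (use Suc C S in \<open>auto simp: compact_space_prod_topology\<close>)
    then show ?thesis using True by simp
  next
    case False
    have "compact_space (pullback_topology {h. is_Final h}
        (\<lambda>h. (final_prev h, final_cons h)) (prod_topology (Htop E t) (Ctop E)))"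
      by (rule compact_space_pullback_topology[where g = "\<lambda>(h, c). Final h c"])
        (use Suc C in \<open>auto simp: compact_space_prod_topology\<close>)
    then show ?thesis using False by simp
  qed
qed

lemma factorizes_eq_imp_odot:
  assumes fac: "factorizes E U X V \<sigma>" and comp: "compatible E P U"
    and "t \<le> Suc (horizon E)" "h \<in> H E t" "h' \<in> H E t" "\<sigma> t h = \<sigma> t h'"
  shows "odot E P U t h h'"
  using assms(3-)
proof (induction t arbitrary: h h' rule: inc_induct)
  case base
  then show ?case
    using fac by (subst odot.simps) (simp add: factorizes_def)
next
  case (step t)
  have t: "t \<le> horizon E" using step.hyps by simp
  have "phys E t h = phys E t h'"
    using fac t step.prems unfolding factorizes_def by (metis le_SucI)
  \<comment> \<open>Compatibility turns indifference into equality of utilities, and both utilities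
    are the generated utility at the common summary.\<close>
  moreover have "indiff P t (h, f) (h', f)" if "f \<in> F E t" for f
    using fac t step.prems that by (simp add: indiff_iff[OF comp] factorizes_def)
  \<comment> \<open>Both extensions have the summary \<open>pa_trans X t (\<sigma> t h) c s\<close>,
    so the induction hypothesis applies to them.\<close>
  moreover have "odot E P U (Suc t) (ext E t h c s) (ext E t h' c s)"
    if "c \<in> C E" "s \<in> St E (Suc t)" for c s
    using fac t step.prems that
    by (intro step.IH ext_mem) (simp_all add: factorizes_def)
  ultimately show ?case
    using t by (subst odot.simps) simp
qed

text \<open>A subtopology intersects its carrier with the ambient space; continuity of
  \<open>\<sigma> t\<close> makes that intersection harmless.\<close>

lemma topspace_reach_top:
  assumes "factorizes E U X V \<sigma>" "t \<le> Suc (horizon E)"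
  shows "topspace (reach_top E X \<sigma> t) = \<sigma> t ` H E t"
proof -
  have "continuous_map (Htop E t) (pa_top X t) (\<sigma> t)"
    using assms by (simp add: factorizes_def)
  then have "\<sigma> t ` H E t \<subseteq> topspace (pa_top X t)"
    unfolding H_def by (rule continuous_map_image_subset_topspace)
  then show ?thesis
    by (auto simp: reach_top_def)
qed

lemma quotient_map_reach_top:
  assumes "is_env E" "pa_state_system E X" and fac: "factorizes E U X V \<sigma>"
    and t: "t \<le> Suc (horizon E)"
  shows "quotient_map (Htop E t) (reach_top E X \<sigma> t) (\<sigma> t)"
proof (rule continuous_imp_quotient_map)
  show "continuous_map (Htop E t) (reach_top E X \<sigma> t) (\<sigma> t)"
    using fac t by (simp add: reach_top_def factorizes_def continuous_map_in_subtopology H_def)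
  show "compact_space (Htop E t)"
    using assms(1) by (rule compact_space_Htop)
  \<comment> \<open>Metrizability of the ambient state space gives the Hausdorff property, which
    subspaces inherit.\<close>
  show "Hausdorff_space (reach_top E X \<sigma> t)"
    using assms(2) t unfolding reach_top_def pa_state_system_def
    by (simp add: Hausdorff_space_subtopology metrizable_imp_Hausdorff_space)
  show "\<sigma> t ` topspace (Htop E t) = topspace (reach_top E X \<sigma> t)"
    using topspace_reach_top[OF fac t] by (simp add: H_def)
qed

text \<open>The condition \<open>\<theta> t (\<sigma> t h) = canon_proj E P U t h\<close> fixes
  every value on the image of \<open>\<sigma> t\<close>; extensionality fixes all others.\<close>

lemma memory_correspondence_unique:
  assumes "memory_correspondence E P U X V \<sigma> \<theta>" "memory_correspondence E P U X V \<sigma> \<eta>"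
  shows "\<theta> = \<eta>"
proof (rule extensionalityI)
  show "\<theta> \<in> extensional {..Suc (horizon E)}" "\<eta> \<in> extensional {..Suc (horizon E)}"
    using assms by (simp_all add: memory_correspondence_def Let_def)
  fix t assume t: "t \<in> {..Suc (horizon E)}"
  show "\<theta> t = \<eta> t"
  proof (rule extensionalityI)
    show "\<theta> t \<in> extensional (\<sigma> t ` H E t)" "\<eta> t \<in> extensional (\<sigma> t ` H E t)"
      using assms t by (simp_all add: memory_correspondence_def Let_def)
    fix x assume "x \<in> \<sigma> t ` H E t"
    then obtain h where h: "h \<in> H E t" "x = \<sigma> t h" by blast
    have "\<zeta> t (\<sigma> t h) = canon_proj E P U t h" if "memory_correspondence E P U X V \<sigma> \<zeta>" for \<zeta>
      using that t h(1) by (simp add: memory_correspondence_def Let_def)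
    from this[OF assms(1)] this[OF assms(2)] show "\<theta> t x = \<eta> t x"
      by (simp add: h(2))
  qed
qed

lemma memory_correspondence_exists:
  assumes env: "is_env E" and comp: "compatible E P U" and pa: "pa_state_system E X"
    and fac: "factorizes E U X V \<sigma>"
  shows "\<exists>\<theta>. memory_correspondence E P U X V \<sigma> \<theta>"
proof -
  let ?T = "horizon E"
  let ?K = "canonical_system E P U"
  \<comment> \<open>Send a summary to the class of an arbitrarily chosen history that produces it.
    The restricted abstractions supply both extensionality conditions.\<close>
  define \<theta> where "\<theta> = (\<lambda>t\<in>{..Suc ?T}. \<lambda>x\<in>\<sigma> t ` H E t.
    canon_proj E P U t (inv_into (H E t) (\<sigma> t) x))"
  have \<theta>: "\<theta> t (\<sigma> t h) = canon_proj E P U t h" if "t \<le> Suc ?T" "h \<in> H E t" for t h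
  proof -
    \<comment> \<open>The chosen history may differ from \<open>h\<close>, but it has the same
      summary and hence the same class.\<close>
    let ?h = "inv_into (H E t) (\<sigma> t) (\<sigma> t h)"
    have h: "?h \<in> H E t" "\<sigma> t ?h = \<sigma> t h"
      using that by (auto intro: inv_into_into f_inv_into_f)
    then have "odot E P U t ?h h"
      using factorizes_eq_imp_odot[OF fac comp] that by blast
    then show ?thesis
      using canon_eq[OF comp that(1) h(1) that(2)] that by (simp add: \<theta>_def)
  qed
  have cont: "continuous_map (reach_top E X \<sigma> t) (pa_top ?K t) (\<theta> t)" if t: "t \<le> Suc ?T" for t
  \<comment> \<open>Continuity out of a quotient can be tested on
    \<open>\<theta> t \<circ> \<sigma> t\<close>, which is the canonical projection.\<close>
  proof (rule continuous_compose_quotient_map[OF quotient_map_reach_top[OF env pa fac t]])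
    have "continuous_map (Htop E t) (pa_top ?K t) (canon_proj E P U t)"
      using canon_quotient_map[OF comp t] by (rule quotient_imp_continuous_map)
    then show "continuous_map (Htop E t) (pa_top ?K t) (\<theta> t \<circ> \<sigma> t)"
      by (rule continuous_map_eq) (use \<theta> t in \<open>simp add: H_def\<close>)
  qed
  \<comment> \<open>Transitions from reachable summaries are summaries of extended histories, so
    they stay reachable and can be compared with \<open>canon_trans\<close>.\<close>
  have trans: "pa_trans X t (\<sigma> t h) c s = \<sigma> (Suc t) (ext E t h c s)"
    if "t \<le> ?T" "h \<in> H E t" "c \<in> C E" "s \<in> St E (Suc t)" for t h c s
    using fac that by (simp add: factorizes_def)
  have "memory_correspondence E P U X V \<sigma> \<theta>"
    unfolding memory_correspondence_def Let_def
  proof (intro conjI allI impI ballI)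
    show "\<theta> \<in> extensional {..Suc ?T}"
      by (simp add: \<theta>_def)
    show "\<theta> t \<in> extensional (\<sigma> t ` H E t)" if "t \<le> Suc ?T" for t
      using that by (simp add: \<theta>_def)
    fix t x c s
    assume t: "t \<le> ?T" and "x \<in> \<sigma> t ` H E t" and cs: "c \<in> C E" "s \<in> St E (Suc t)"
    then obtain h where h: "h \<in> H E t" "x = \<sigma> t h" by blast
    note mem = ext_mem[OF t h(1) cs]
    show "pa_trans X t x c s \<in> \<sigma> (Suc t) ` H E (Suc t)"
      using mem trans[OF t h(1) cs] h(2) by simp
    show "\<theta> (Suc t) (pa_trans X t x c s) = pa_trans ?K t (\<theta> t x) c s"
      using mem trans[OF t h(1) cs] h t canon_trans[OF comp t h(1) cs] by (simp add: \<theta>)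
  next
    fix t x f assume "t \<le> ?T" "x \<in> \<sigma> t ` H E t" "f \<in> F E t"
    then show "gen_util E X V t x f = quot_util U t (\<theta> t x) f"
      using fac by (auto simp: \<theta> quot_util_eq[OF comp] factorizes_def)
  next
    fix x assume "x \<in> \<sigma> (Suc ?T) ` H E (Suc ?T)"
    then show "term_val V x = quot_util_end U (\<theta> (Suc ?T) x)"
      using fac by (auto simp: \<theta> quot_util_end_eq[OF comp] factorizes_def)
  qed (use \<theta> cont in auto)
  then show ?thesis by blast
qed

lemma memory_correspondence_homeomorphic_map:
  assumes env: "is_env E" and comp: "compatible E P U" and pa: "pa_state_system E X"
    and fac: "factorizes E U X V \<sigma>" and mem: "memory_correspondence E P U X V \<sigma> \<theta>"
    and t: "t \<le> Suc (horizon E)"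
    and odot: "\<And>h h'. \<lbrakk>h \<in> H E t; h' \<in> H E t; odot E P U t h h'\<rbrakk> \<Longrightarrow> \<sigma> t h = \<sigma> t h'"
  shows "homeomorphic_map (reach_top E X \<sigma> t) (pa_top (canonical_system E P U) t) (\<theta> t)"
proof -
  let ?K = "pa_top (canonical_system E P U) t"
  have \<theta>: "\<theta> t (\<sigma> t h) = canon_proj E P U t h" if "h \<in> H E t" for h
    using mem t that by (simp add: memory_correspondence_def Let_def)
  have "quotient_map (Htop E t) ?K (\<theta> t \<circ> \<sigma> t)"
    using canon_quotient_map[OF comp t] by (rule quotient_map_eq) (simp add: \<theta> H_def)
  moreover have "continuous_map (reach_top E X \<sigma> t) ?K (\<theta> t)"
    using mem t by (simp add: memory_correspondence_def Let_def)
  \<comment> \<open>When a composite of continuous maps is a quotient map, so is its outer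
    factor.\<close>
  ultimately have "quotient_map (reach_top E X \<sigma> t) ?K (\<theta> t)"
    using quotient_map_from_composition
      quotient_imp_continuous_map[OF quotient_map_reach_top[OF env pa fac t]] by blast
  \<comment> \<open>Equal values mean equal canonical classes of the underlying histories, hence
    \<open>odot\<close>-equivalence, and the hypothesis \<open>odot\<close> then identifies their
    summaries.\<close>
  moreover have "inj_on (\<theta> t) (topspace (reach_top E X \<sigma> t))"
    unfolding topspace_reach_top[OF fac t]
    using odot canon_eq[OF comp t] by (auto simp: inj_on_def \<theta>)
  ultimately show ?thesis
    by (simp add: homeomorphic_map_def)
qed

theorem proposition4p15:
  fixes E :: "'s env"
    and P :: "'s grand_pref"
    and U :: "'s utils"
    and X' :: "('s, 'x) pa_system"
    and V' :: "('s, 'x) pa_struct"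
    and \<sigma>' :: "nat \<Rightarrow> 's hist \<Rightarrow> 'x"
  assumes "is_env E"
    and "grand_preference E P"
    and "utility_system E U"
    and "compatible E P U"
    and "pa_state_system E X'"
    and "pa_recursive_structure E X' V'"
    and "factorizes E U X' V' \<sigma>'"
  shows "(\<exists>!\<theta>. memory_correspondence E P U X' V' \<sigma>' \<theta>) \<and>
    ((\<forall>t\<le>Suc (horizon E). \<forall>h\<in>H E t. \<forall>h'\<in>H E t. odot E P U t h h' \<longrightarrow> \<sigma>' t h = \<sigma>' t h') \<longrightarrow>
     (\<forall>\<theta>. memory_correspondence E P U X' V' \<sigma>' \<theta> \<longrightarrow>
       (\<forall>t\<le>Suc (horizon E).
          homeomorphic_map (reach_top E X' \<sigma>' t)
            (pa_top (canonical_system E P U) t) (\<theta> t))))"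
  using memory_correspondence_exists[OF assms(1,4,5,7)] memory_correspondence_unique
    memory_correspondence_homeomorphic_map[OF assms(1,4,5,7)]
  by blast

end
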